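(* Let $\hbar>0$, $\nu>\hbar/2$ and $u=(2\nu/\hbar)^2>1$. Let $G_0^{\rm Frob}$ and $G_2^{\rm Frob}$ be the minima of the Frobenius cost $F_{\rm Frob}(K)^2=\frac14\operatorname{Tr}(K^{\mathsf T}K)$ over all $K\in\mathfrak{sp}(4,\mathbb R)$ that induce, at the canonical purification of $\nu\mathbb I_2$, the reduced tangent $X_0=\mathbb I_2$, respectively $X_2=Z$. Then $$R_{\rm Frob}(u):=\frac{G_0^{\rm Frob}}{G_2^{\rm Frob}}=\frac{3u-1}{u-1},$$ and $R_{\rm Frob}(u)\neq R_{\rm B}(u)$ for every $u>1$, where $R_{\rm B}(u)=\frac{u+1}{u-1}$ is the Bures radial-to-traceless squared-cost ratio.
   Context: Let $\Omega=\begin{pmatrix}0&1\\-1&0\end{pmatrix}$, $Z=\begin{pmatrix}1&0\\0&-1\end{pmatrix}$, $\kappa_\nu=\sqrt{\nu^2-\hbar^2/4}$. The canonical purification of the one-mode covariance $\nu\mathbb I_2$ has covariance $\Gamma_\nu=\begin{pmatrix}\nu\mathbb I_2&\kappa_\nu Z\\ \kappa_\nu Z&\nu\mathbb I_2\end{pmatrix}$. With symplectic form $\Omega\oplus\Omega$, every $K\in\mathfrak{sp}(4,\mathbb R)$ has the block form $$K=\begin{pmatrix}A&B\\ \Omega B^{\mathsf T}\Omega&D\end{pmatrix},\qquad A,D\in\mathfrak{sp}(2,\mathbb R)\ (\text{real traceless } 2\times2),\quad B\in\mathbb R^{2\times2}\text{ arbitrary}.$$ $K$ induces the reduced tangent $X$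 (a real symmetric $2\times2$ matrix) if the upper-left (system) $2\times2$ block of $K\Gamma_\nu+\Gamma_\nu K^{\mathsf T}$ equals $X$, i.e. $$X=\nu(A+A^{\mathsf T})+\kappa_\nu(BZ+ZB^{\mathsf T}).$$ The Bures ratio $R_{\rm B}(u)=(u+1)/(u-1)$ is the ratio $g_{\rm B}(\mathbb I_2,\mathbb I_2)/g_{\rm B}(Z,Z)$ of the Gaussian Bures metric at the covariance $\nu\mathbb I_2$. *)

theory Defs
  imports "HOL-Analysis.Analysis"
begin

definition Omega :: "real^2^2"
  where "Omega = vector [vector [0, 1], vector [-1, 0]]"

definition pauli_Z :: "real^2^2"
  where "pauli_Z = vector [vector [1, 0], vector [0, -1]]"

text \<open>Two-mode phase space is indexed by the sum type \<open>2 + 2\<close>: \<open>Inl\<close> indexes the system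
  mode and \<open>Inr\<close> the purifying mode.\<close>

type_synonym mat4 = "real^(2 + 2)^(2 + 2)"

definition block_mat :: "real^2^2 \<Rightarrow> real^2^2 \<Rightarrow> real^2^2 \<Rightarrow> real^2^2 \<Rightarrow> mat4"
  where "block_mat A B C D = (\<chi> i j.
    case i of
      Inl a \<Rightarrow> (case j of Inl b \<Rightarrow> A $ a $ b | Inr b \<Rightarrow> B $ a $ b)
    | Inr a \<Rightarrow> (case j of Inl b \<Rightarrow> C $ a $ b | Inr b \<Rightarrow> D $ a $ b))"

definition system_block :: "mat4 \<Rightarrow> real^2^2"
  where "system_block M = (\<chi> a b. M $ Inl a $ Inl b)"

definition symplectic_form4 :: mat4
  where "symplectic_form4 = block_mat Omega 0 0 Omega"

definition sp4 :: "mat4 set"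
  where "sp4 = {K. transpose K ** symplectic_form4 + symplectic_form4 ** K = 0}"

definition kappa :: "real \<Rightarrow> real \<Rightarrow> real"
  where "kappa hbar \<nu> = sqrt (\<nu>\<^sup>2 - hbar\<^sup>2 / 4)"

definition purification_cov :: "real \<Rightarrow> real \<Rightarrow> mat4"
  where "purification_cov hbar \<nu> =
    block_mat (\<nu> *\<^sub>R mat 1) (kappa hbar \<nu> *\<^sub>R pauli_Z)
              (kappa hbar \<nu> *\<^sub>R pauli_Z) (\<nu> *\<^sub>R mat 1)"

definition induces_tangent :: "real \<Rightarrow> real \<Rightarrow> mat4 \<Rightarrow> real^2^2 \<Rightarrow> bool"
  where "induces_tangent hbar \<nu> K X \<longleftrightarrow>
    system_block (K ** purification_cov hbar \<nu> + purification_cov hbar \<nu> ** transpose K) = X"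

definition frob_sq_cost :: "mat4 \<Rightarrow> real"
  where "frob_sq_cost K = trace (transpose K ** K) / 4"

definition feasible :: "real \<Rightarrow> real \<Rightarrow> real^2^2 \<Rightarrow> mat4 set"
  where "feasible hbar \<nu> X = {K \<in> sp4. induces_tangent hbar \<nu> K X}"

text \<open>The infimum of the squared cost; it is the minimum exactly when a minimizer
  (\<open>is_arg_min\<close>) exists, which has to be established separately.\<close>

definition G_Frob :: "real \<Rightarrow> real \<Rightarrow> real^2^2 \<Rightarrow> real"
  where "G_Frob hbar \<nu> X = (INF K \<in> feasible hbar \<nu> X. frob_sq_cost K)"

definition R_Frob :: "real \<Rightarrow> real \<Rightarrow> real"
  where "R_Frob hbar \<nu> = G_Frob hbar \<nu> (mat 1) / G_Frob hbar \<nu> pauli_Z"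

text \<open>The Bures metric of centred one-mode Gaussian states at a covariance \<open>V\<close> with vacuum
  covariance \<open>hbar/2\<close> times the identity: the symmetric logarithmic derivative along a
  covariance tangent \<open>Y\<close> has as quadratic part, up to a factor, the solution \<open>L\<close> of
  \<open>V L V + (hbar\<^sup>2/4) Omega L Omega = Y\<close>. The quantum Fisher information is half of
  \<open>trace (X L)\<close>, and the Bures metric is a quarter of that. The solution \<open>L\<close> is unique
  whenever the symplectic eigenvalue of \<open>V\<close> exceeds \<open>hbar/2\<close>.\<close>

definition gaussian_bures_metric ::
    "real \<Rightarrow> real^2^2 \<Rightarrow> real^2^2 \<Rightarrow> real^2^2 \<Rightarrow> real"
  where "gaussian_bures_metric hbar V X Y =
    trace (X ** (THE L. V ** L ** V + (hbar\<^sup>2 / 4) *\<^sub>R (Omega ** L ** Omega) = Y)) / 8"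

definition R_Bures :: "real \<Rightarrow> real"
  where "R_Bures u = (u + 1) / (u - 1)"

end

theory Submission imports Defs begin

text \<open>Writing \<open>B\<close> with rows \<open>(p, q)\<close> and \<open>(r, s)\<close> and \<open>A\<close> with diagonal \<open>(a, -a)\<close>, the
  symplectic condition forces the lower-left block to have the diagonal \<open>(-s, -p)\<close>, so that the
  cost is at least \<open>(a\<^sup>2 + p\<^sup>2 + s\<^sup>2) / 2\<close>. The diagonal of the induced tangent is
  \<open>(2 \<nu> a + 2 \<kappa> p, - 2 \<nu> a - 2 \<kappa> s)\<close>. For \<open>mat 1\<close> the variable \<open>a\<close> drops out of the sum
  of the two diagonal equations, leaving \<open>\<kappa> (p - s) = 1\<close>; for \<open>pauli_Z\<close> the
  difference involves all three coordinates, \<open>4 \<nu> a + 2 \<kappa> p + 2 \<kappa> s = 2\<close>. By the Cauchy--Schwarz inequality the minima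
  are \<open>1 / (4 \<kappa>\<^sup>2)\<close> and \<open>1 / (4 (2 \<nu>\<^sup>2 + \<kappa>\<^sup>2))\<close>.\<close>

section \<open>Block calculus over the sum index type, and the feasible set in blocks\<close>

lemma sum_UNIV_Plus:
  fixes f :: "'a::finite + 'b::finite \<Rightarrow> 'c::comm_monoid_add"
  shows "sum f UNIV = (\<Sum>a\<in>UNIV. f (Inl a)) + (\<Sum>b\<in>UNIV. f (Inr b))"
  by (simp add: UNIV_Plus_UNIV[symmetric] sum.Plus del: UNIV_Plus_UNIV)

lemma forall_Plus: "(\<forall>x. P x) \<longleftrightarrow> (\<forall>a. P (Inl a)) \<and> (\<forall>b. P (Inr b))"
  by (metis sum.exhaust)

lemmas mat2_simps = vec_eq_iff forall_2 matrix_matrix_mult_def transpose_def trace_def sum_2 mat_def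
  Omega_def pauli_Z_def

lemma block_mat_cases:
  obtains A B C D where "K = block_mat A B C D"
proof
  show "K = block_mat (\<chi> a b. K $ Inl a $ Inl b) (\<chi> a b. K $ Inl a $ Inr b)
                      (\<chi> a b. K $ Inr a $ Inl b) (\<chi> a b. K $ Inr a $ Inr b)"
    by (simp add: block_mat_def vec_eq_iff forall_Plus)
qed

lemma block_mat_eq_iff:
  "block_mat A B C D = block_mat A' B' C' D' \<longleftrightarrow> A = A' \<and> B = B' \<and> C = C' \<and> D = D'"
  by (simp add: block_mat_def vec_eq_iff forall_Plus) blast

lemma block_mat_0: "block_mat 0 0 0 0 = 0"
  by (simp add: block_mat_def vec_eq_iff forall_Plus)

lemma block_mat_add:
  "block_mat A B C D + block_mat A' B' C' D' = block_mat (A + A') (B + B') (C + C') (D + D')"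
  by (simp add: block_mat_def vec_eq_iff forall_Plus)

lemma block_mat_mult:
  "block_mat A B C D ** block_mat A' B' C' D' =
   block_mat (A ** A' + B ** C') (A ** B' + B ** D') (C ** A' + D ** C') (C ** B' + D ** D')"
  by (simp add: block_mat_def vec_eq_iff forall_Plus matrix_matrix_mult_def sum_UNIV_Plus)

lemma transpose_block_mat:
  "transpose (block_mat A B C D) =
   block_mat (transpose A) (transpose C) (transpose B) (transpose D)"
  by (simp add: block_mat_def vec_eq_iff forall_Plus transpose_def)

lemma trace_block_mat: "trace (block_mat A B C D) = trace A + trace D"
  by (simp add: block_mat_def trace_def sum_UNIV_Plus)

lemma system_block_block_mat: "system_block (block_mat A B C D) = A"
  by (simp add: block_mat_def system_block_def vec_eq_iff)

text \<open>A 2 by 2 matrix satisfies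
  \<open>transpose X ** Omega + Omega ** X = trace X *\<^sub>R Omega\<close>, so the diagonal blocks
  say exactly that \<open>A\<close> and \<open>D\<close> are traceless. The two off-diagonal
  equations are negative transposes of each other, and either one is solved for \<open>C\<close>
  because \<open>Omega\<close> squares to minus the identity.\<close>

lemma block_mat_in_sp4_iff:
  "block_mat A B C D \<in> sp4 \<longleftrightarrow>
   trace A = 0 \<and> trace D = 0 \<and> C = Omega ** transpose B ** Omega"
proof -
  have "transpose X ** Omega + Omega ** X = 0 \<longleftrightarrow> trace X = 0" for X
    by (auto simp: mat2_simps)
  moreover have "transpose C ** Omega + Omega ** B = 0 \<longleftrightarrow> C = Omega ** transpose B ** Omega"
    by (auto simp: mat2_simps)
  moreover have "transpose B ** Omega + Omega ** C = 0 \<longleftrightarrow> C = Omega ** transpose B ** Omega"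
    by (auto simp: mat2_simps)
  ultimately show ?thesis
    by (auto simp: sp4_def symplectic_form4_def transpose_block_mat block_mat_mult block_mat_add
        block_mat_0[symmetric] block_mat_eq_iff)
qed

lemma induces_tangent_block_mat_iff:
  "induces_tangent hbar \<nu> (block_mat A B C D) X \<longleftrightarrow>
   \<nu> *\<^sub>R (A + transpose A) + kappa hbar \<nu> *\<^sub>R (B ** pauli_Z + pauli_Z ** transpose B) = X"
proof -
  have "system_block (block_mat A B C D ** purification_cov hbar \<nu> +
          purification_cov hbar \<nu> ** transpose (block_mat A B C D)) =
        \<nu> *\<^sub>R (A + transpose A) + kappa hbar \<nu> *\<^sub>R (B ** pauli_Z + pauli_Z ** transpose B)"
    unfolding purification_cov_def transpose_block_mat block_mat_mult block_mat_add
      system_block_block_mat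
    by (simp add: mat2_simps algebra_simps)
  then show ?thesis
    by (simp add: induces_tangent_def)
qed

lemma block_mat_in_feasible_iff:
  "block_mat A B C D \<in> feasible hbar \<nu> X \<longleftrightarrow>
   trace A = 0 \<and> trace D = 0 \<and> C = Omega ** transpose B ** Omega \<and>
   \<nu> *\<^sub>R (A + transpose A) + kappa hbar \<nu> *\<^sub>R (B ** pauli_Z + pauli_Z ** transpose B) = X"
  by (simp add: feasible_def block_mat_in_sp4_iff induces_tangent_block_mat_iff)

lemma frob_sq_cost_block_mat:
  "frob_sq_cost (block_mat A B C D) =
   (trace (transpose A ** A) + trace (transpose B ** B) +
    trace (transpose C ** C) + trace (transpose D ** D)) / 4"
  by (simp add: frob_sq_cost_def transpose_block_mat block_mat_mult trace_block_mat trace_add)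

section \<open>Reduction to three real variables\<close>

definition diag2 :: "real \<Rightarrow> real \<Rightarrow> real^2^2"
  where "diag2 x y = vector [vector [x, 0], vector [0, y]]"

text \<open>The candidate minimizers: all entries that would only add cost are set to zero. The
  third block is \<open>Omega ** transpose B ** Omega\<close> for
  \<open>B = diag2 p s\<close>.\<close>

definition diag_lift :: "real \<Rightarrow> real \<Rightarrow> real \<Rightarrow> mat4"
  where "diag_lift a p s = block_mat (diag2 a (- a)) (diag2 p s) (diag2 (- s) (- p)) 0"

lemma diag_lift_in_feasible:
  assumes "2 * \<nu> * a + 2 * kappa hbar \<nu> * p = x" and "- 2 * \<nu> * a - 2 * kappa hbar \<nu> * s = y"
  shows "diag_lift a p s \<in> feasible hbar \<nu> (diag2 x y)"
  using assms
  by (simp add: diag_lift_def block_mat_in_feasible_iff mat2_simps diag2_def algebra_simps)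

lemma frob_sq_cost_diag_lift: "frob_sq_cost (diag_lift a p s) = (a\<^sup>2 + p\<^sup>2 + s\<^sup>2) / 2"
  by (simp add: diag_lift_def frob_sq_cost_block_mat mat2_simps diag2_def power2_eq_square)

text \<open>Up to sign, each of \<open>a\<close>, \<open>p\<close>, \<open>s\<close> occurs in two
  entries of \<open>K\<close>, which turns the factor 1/4 of the cost into 1/2; the squares of the
  other entries are dropped. Since \<open>diag_lift\<close> attains the bound, only a minimization
  over \<open>a\<close>, \<open>p\<close>, \<open>s\<close> remains.\<close>

lemma feasible_diag_lower_bound:
  assumes "K \<in> feasible hbar \<nu> (diag2 x y)"
  obtains a p s where "2 * \<nu> * a + 2 * kappa hbar \<nu> * p = x"
    and "- 2 * \<nu> * a - 2 * kappa hbar \<nu> * s = y"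
    and "(a\<^sup>2 + p\<^sup>2 + s\<^sup>2) / 2 \<le> frob_sq_cost K"
proof -
  obtain A B C D where K: "K = block_mat A B C D"
    by (rule block_mat_cases)
  define a p s where "a = A $ 1 $ 1" and "p = B $ 1 $ 1" and "s = B $ 2 $ 2"
  have A22: "A $ 2 $ 2 = - a"
    using assms by (simp add: K block_mat_in_feasible_iff trace_def sum_2 a_def)
  have C: "C $ 1 $ 1 = - s" "C $ 2 $ 2 = - p"
    using assms by (simp_all add: K block_mat_in_feasible_iff mat2_simps p_def s_def)
  have "\<nu> *\<^sub>R (A + transpose A) + kappa hbar \<nu> *\<^sub>R (B ** pauli_Z + pauli_Z ** transpose B) = diag2 x y"
    using assms by (simp add: K block_mat_in_feasible_iff)
  then have eqs: "2 * \<nu> * a + 2 * kappa hbar \<nu> * p = x" "- 2 * \<nu> * a - 2 * kappa hbar \<nu> * s = y"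
    using A22 by (simp_all add: mat2_simps diag2_def a_def p_def s_def algebra_simps)
  have trace_sq: "trace (transpose M ** M) =
      (M $ 1 $ 1)\<^sup>2 + (M $ 1 $ 2)\<^sup>2 + (M $ 2 $ 1)\<^sup>2 + (M $ 2 $ 2)\<^sup>2" for M :: "real^2^2"
    by (simp add: mat2_simps power2_eq_square)
  have "(a\<^sup>2 + p\<^sup>2 + s\<^sup>2) / 2 \<le> frob_sq_cost K"
    unfolding K frob_sq_cost_block_mat trace_sq A22 C
    by (simp add: a_def[symmetric] p_def[symmetric] s_def[symmetric] add_nonneg_nonneg)
  with eqs show thesis
    by (rule that)
qed

section \<open>Minimization under a linear constraint\<close>

lemma is_arg_min_imp_INF_eq:
  fixes f :: "'a \<Rightarrow> real"
  assumes "is_arg_min f (\<lambda>x. x \<in> S) a"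
  shows "(INF x\<in>S. f x) = f a"
  using assms by (intro cInf_eq_minimum) (auto simp: is_arg_min_linorder)

text \<open>The minimizer is the equality case of Cauchy--Schwarz for \<open>l a + m p + n s = 1\<close>, hence
  proportional to \<open>(l, m, n)\<close>.\<close>

lemma frob_sq_cost_minimizer:
  assumes "2 * \<nu> * (l / t) + 2 * kappa hbar \<nu> * (m / t) = x"
    and "- 2 * \<nu> * (l / t) - 2 * kappa hbar \<nu> * (n / t) = y"
    and t: "t = l\<^sup>2 + m\<^sup>2 + n\<^sup>2" "t > 0"
    and functional: "\<And>a p s. \<lbrakk>2 * \<nu> * a + 2 * kappa hbar \<nu> * p = x;
        - 2 * \<nu> * a - 2 * kappa hbar \<nu> * s = y\<rbrakk> \<Longrightarrow> l * a + m * p + n * s = 1"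
  shows "is_arg_min frob_sq_cost (\<lambda>K. K \<in> feasible hbar \<nu> (diag2 x y))
           (diag_lift (l / t) (m / t) (n / t))" (is ?min)
    and "G_Frob hbar \<nu> (diag2 x y) = 1 / (2 * t)"
proof -
  have "(l / t)\<^sup>2 + (m / t)\<^sup>2 + (n / t)\<^sup>2 = t / t\<^sup>2"
    by (simp add: t(1) power_divide add_divide_distrib)
  then have cost: "frob_sq_cost (diag_lift (l / t) (m / t) (n / t)) = 1 / (2 * t)"
    using t(2) by (simp add: frob_sq_cost_diag_lift power2_eq_square)
  have "1 / (2 * t) \<le> frob_sq_cost K" if "K \<in> feasible hbar \<nu> (diag2 x y)" for K
  proof -
    obtain a p s where
      "2 * \<nu> * a + 2 * kappa hbar \<nu> * p = x" "- 2 * \<nu> * a - 2 * kappa hbar \<nu> * s = y"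
      and le: "(a\<^sup>2 + p\<^sup>2 + s\<^sup>2) / 2 \<le> frob_sq_cost K"
      using feasible_diag_lower_bound \<open>K \<in> feasible hbar \<nu> (diag2 x y)\<close> by metis
    then have one: "l * a + m * p + n * s = 1"
      using functional by blast
    \<comment> \<open>Cauchy-Schwarz in the form of a nonnegative squared distance to the minimizer;
      the constraint makes the cross term equal to \<open>- 2 / t\<close>.\<close>
    have "0 \<le> (a - l / t)\<^sup>2 + (p - m / t)\<^sup>2 + (s - n / t)\<^sup>2"
      by simp
    also have "\<dots> = a\<^sup>2 + p\<^sup>2 + s\<^sup>2 - 2 * (l * a + m * p + n * s) / t
        + ((l / t)\<^sup>2 + (m / t)\<^sup>2 + (n / t)\<^sup>2)"
      by (simp add: power2_diff add_divide_distrib algebra_simps)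
    also have "\<dots> = a\<^sup>2 + p\<^sup>2 + s\<^sup>2 - 1 / t"
      using one \<open>_ = t / t\<^sup>2\<close> t(2) by (simp add: power2_eq_square)
    finally show ?thesis
      using le by (simp add: field_simps)
  qed
  with cost show ?min
    using diag_lift_in_feasible[OF assms(1,2)] by (simp add: is_arg_min_linorder)
  then show "G_Frob hbar \<nu> (diag2 x y) = 1 / (2 * t)"
    unfolding G_Frob_def by (simp only: is_arg_min_imp_INF_eq cost)
qed

lemma mat_1_eq_diag2: "mat 1 = diag2 1 1"
  by (simp add: mat2_simps diag2_def)

lemma pauli_Z_eq_diag2: "pauli_Z = diag2 1 (- 1)"
  by (simp add: mat2_simps diag2_def)

section \<open>The Bures metric on diagonal tangents\<close>

lemma Omega_sandwich_diag2: "Omega ** diag2 x y ** Omega = diag2 (- y) (- x)"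
  by (simp add: mat2_simps diag2_def)

text \<open>The map sending \<open>L\<close> to \<open>Omega ** L ** Omega\<close> is an involution,
  so its eigenvalues are 1 and -1. The left-hand side is therefore a linear operator with
  eigenvalues \<open>\<nu>\<^sup>2 + c\<close> and \<open>\<nu>\<^sup>2 - c\<close>, both
  nonzero.\<close>

lemma SLD_equation_solution:
  fixes L Y :: "real^2^2"
  assumes "\<bar>c\<bar> < \<nu>\<^sup>2"
    and "(\<nu> *\<^sub>R mat 1) ** L0 ** (\<nu> *\<^sub>R mat 1) + c *\<^sub>R (Omega ** L0 ** Omega) = Y"
  shows "(THE L. (\<nu> *\<^sub>R mat 1) ** L ** (\<nu> *\<^sub>R mat 1) + c *\<^sub>R (Omega ** L ** Omega) = Y) = L0"
proof (rule the_equality)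
  show "(\<nu> *\<^sub>R mat 1) ** L0 ** (\<nu> *\<^sub>R mat 1) + c *\<^sub>R (Omega ** L0 ** Omega) = Y"
    by (fact assms(2))
next
  fix L :: "real^2^2"
  assume L: "(\<nu> *\<^sub>R mat 1) ** L ** (\<nu> *\<^sub>R mat 1) + c *\<^sub>R (Omega ** L ** Omega) = Y"
  define E where "E = L - L0"
  have diag: "\<nu>\<^sup>2 * E $ 1 $ 1 = c * E $ 2 $ 2" "\<nu>\<^sup>2 * E $ 2 $ 2 = c * E $ 1 $ 1"
    and off: "\<nu>\<^sup>2 * E $ 1 $ 2 = - c * E $ 2 $ 1" "\<nu>\<^sup>2 * E $ 2 $ 1 = - c * E $ 1 $ 2"
    using L assms(2) by (auto simp: E_def mat2_simps power2_eq_square algebra_simps)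
  have ne: "\<nu>\<^sup>2 + c \<noteq> 0" "\<nu>\<^sup>2 - c \<noteq> 0"
    using assms(1) by auto
  \<comment> \<open>These four combinations are the coordinates of \<open>E\<close>, up to a factor,
    in an eigenbasis of the involution.\<close>
  have "(\<nu>\<^sup>2 - c) * (E $ 1 $ 1 + E $ 2 $ 2) = 0" "(\<nu>\<^sup>2 + c) * (E $ 1 $ 1 - E $ 2 $ 2) = 0"
    "(\<nu>\<^sup>2 + c) * (E $ 1 $ 2 + E $ 2 $ 1) = 0" "(\<nu>\<^sup>2 - c) * (E $ 1 $ 2 - E $ 2 $ 1) = 0"
    using diag off by (auto simp: algebra_simps)
  with ne have "E = 0"
    by (auto simp: vec_eq_iff forall_2)
  then show "L = L0"
    by (simp add: E_def)
qed

lemma gaussian_bures_metric_diag2: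
  assumes "hbar\<^sup>2 / 4 < \<nu>\<^sup>2" and "\<nu>\<^sup>2 * x - hbar\<^sup>2 / 4 * y = z" and "\<nu>\<^sup>2 * y - hbar\<^sup>2 / 4 * x = w"
  shows "gaussian_bures_metric hbar (\<nu> *\<^sub>R mat 1) X (diag2 z w) = trace (X ** diag2 x y) / 8"
proof -
  have "(\<nu> *\<^sub>R mat 1) ** diag2 x y ** (\<nu> *\<^sub>R mat 1)
      + (hbar\<^sup>2 / 4) *\<^sub>R (Omega ** diag2 x y ** Omega) = diag2 z w"
    unfolding Omega_sandwich_diag2 using assms(2,3)
    by (simp add: mat2_simps diag2_def power2_eq_square algebra_simps)
  then show ?thesis
    unfolding gaussian_bures_metric_def using assms(1) by (subst SLD_equation_solution) auto
qed

theorem proposition6p1: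
  fixes hbar \<nu> u :: real
  assumes "hbar > 0" and "\<nu> > hbar / 2" and "u = (2 * \<nu> / hbar)\<^sup>2"
  shows "u > 1
    \<and> (\<exists>K. is_arg_min frob_sq_cost (\<lambda>K. K \<in> feasible hbar \<nu> (mat 1)) K)
    \<and> (\<exists>K. is_arg_min frob_sq_cost (\<lambda>K. K \<in> feasible hbar \<nu> pauli_Z) K)
    \<and> R_Frob hbar \<nu> = (3 * u - 1) / (u - 1)
    \<and> R_Frob hbar \<nu> \<noteq> R_Bures u
    \<and> R_Bures u = gaussian_bures_metric hbar (\<nu> *\<^sub>R mat 1) (mat 1) (mat 1)
                  / gaussian_bures_metric hbar (\<nu> *\<^sub>R mat 1) pauli_Z pauli_Z"
proof -
  \<comment> \<open>In terms of \<open>h\<close>, \<open>\<nu>\<^sup>2 = u * h\<close> and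
    \<open>k\<^sup>2 = (u - 1) * h\<close>, so \<open>h\<close> cancels from both ratios.\<close>
  define h k where "h = hbar\<^sup>2 / 4" and "k = kappa hbar \<nu>"
  have h: "h > 0"
    using assms(1) by (simp add: h_def)
  have \<nu>: "\<nu>\<^sup>2 = u * h"
    using assms(1,3) by (simp add: h_def power_divide power_mult_distrib)
  have "1 < 2 * \<nu> / hbar"
    using assms(1,2) by (simp add: field_simps)
  then have u: "u > 1"
    using assms(3) by (simp add: one_less_power)
  have h_less: "h < \<nu>\<^sup>2"
    using h u by (simp add: \<nu>)
  then have k: "k > 0" and k2: "k\<^sup>2 = (u - 1) * h"
    by (simp_all add: k_def kappa_def h_def[symmetric] \<nu> algebra_simps)
  \<comment> \<open>Half the sum of the diagonal equations is \<open>k * p - k * s = 1\<close>,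
    which gives the coefficients 0, \<open>k\<close>, \<open>- k\<close>.\<close>
  have min0: "is_arg_min frob_sq_cost (\<lambda>K. K \<in> feasible hbar \<nu> (diag2 1 1))
      (diag_lift (0 / (2 * k\<^sup>2)) (k / (2 * k\<^sup>2)) (- k / (2 * k\<^sup>2)))"
    and G0: "G_Frob hbar \<nu> (diag2 1 1) = 1 / (2 * (2 * k\<^sup>2))"
    by (rule frob_sq_cost_minimizer[where l = 0 and m = k and n = "- k"];
        use k in \<open>simp add: k_def[symmetric] power2_eq_square algebra_simps\<close>)+
  \<comment> \<open>The squared norm of the coefficients in
    \<open>2 * \<nu> * a + k * p + k * s = 1\<close>, which is half the difference of the diagonal
    equations for \<open>pauli_Z\<close>.\<close>
  define t where "t = 4 * \<nu>\<^sup>2 + 2 * k\<^sup>2"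
  have t: "t > 0"
    using k by (simp add: t_def add_nonneg_pos)
  have min2: "is_arg_min frob_sq_cost (\<lambda>K. K \<in> feasible hbar \<nu> (diag2 1 (- 1)))
      (diag_lift (2 * \<nu> / t) (k / t) (k / t))"
    and G2: "G_Frob hbar \<nu> (diag2 1 (- 1)) = 1 / (2 * t)"
    by (rule frob_sq_cost_minimizer[where l = "2 * \<nu>" and m = k and n = k];
        use t in \<open>simp add: k_def[symmetric] field_simps; simp add: t_def power2_eq_square\<close>)+
  have R: "R_Frob hbar \<nu> = (3 * u - 1) / (u - 1)"
    using h u
    by (simp add: R_Frob_def mat_1_eq_diag2 pauli_Z_eq_diag2 G0 G2 t_def \<nu> k2 divide_simps)
       (simp add: algebra_simps)
  \<comment> \<open>The denominators agree, and equal numerators would force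
    \<open>u = 1\<close>.\<close>
  have "R_Frob hbar \<nu> \<noteq> R_Bures u"
    using u by (simp add: R R_Bures_def)
  \<comment> \<open>The identity and \<open>pauli_Z\<close> are eigenvectors of the operator
    defining \<open>L\<close>, with eigenvalues \<open>\<nu>\<^sup>2 - h\<close> and
    \<open>\<nu>\<^sup>2 + h\<close>; each solution is the tangent divided by its
    eigenvalue.\<close>
  moreover have "gaussian_bures_metric hbar (\<nu> *\<^sub>R mat 1) (diag2 1 1) (diag2 1 1)
      = 1 / (4 * (\<nu>\<^sup>2 - h))"
    using h_less
    by (subst gaussian_bures_metric_diag2[where x = "1 / (\<nu>\<^sup>2 - h)" and y = "1 / (\<nu>\<^sup>2 - h)"])
       (simp_all add: h_def[symmetric] mat2_simps diag2_def divide_simps)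
  moreover have "gaussian_bures_metric hbar (\<nu> *\<^sub>R mat 1) (diag2 1 (- 1)) (diag2 1 (- 1))
      = 1 / (4 * (\<nu>\<^sup>2 + h))"
    using h h_less
    by (subst gaussian_bures_metric_diag2[where x = "1 / (\<nu>\<^sup>2 + h)" and y = "- 1 / (\<nu>\<^sup>2 + h)"])
       (simp_all add: h_def[symmetric] mat2_simps diag2_def divide_simps)
  moreover have "R_Bures u = (1 / (4 * (\<nu>\<^sup>2 - h))) / (1 / (4 * (\<nu>\<^sup>2 + h)))"
  proof -
    have "\<nu>\<^sup>2 + h = (u + 1) * h" "\<nu>\<^sup>2 - h = (u - 1) * h"
      by (simp_all add: \<nu> algebra_simps)
    then show ?thesis
      using h by (simp add: R_Bures_def)
  qed
  ultimately show ?thesis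
    using u R min0 min2 by (metis mat_1_eq_diag2 pauli_Z_eq_diag2)
qed

end
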